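(* Let $Y$ be a random variable whose moment generating function $E[e^{tY}]$ exists for $|t|<\delta$ for some $\delta>0$. Let $r$ be a positive integer and for $k\ge0$ define ${n+r\brace k+r}_{r,Y}$ ($n\ge k$) by $$\frac{1}{k!}\big(E[e^{tY}]-1\big)^k e^{rt}=\sum_{n=k}^{\infty}{n+r\brace k+r}_{r,Y}\frac{t^n}{n!},$$ and define $\phi^Y_{n,r}(x)=\sum_{k=0}^{n}{n+r\brace k+r}_{r,Y}x^k$. Then for all $n\ge0$, $$\phi^Y_{n,r}(x)=\sum_{l=0}^{n}\binom{n}{l}\sum_{k=0}^{l}B_{l,k}\big(xE[Y],xE[Y^2],\dots,xE[Y^{l-k+1}]\big)r^{n-l}.$$
   Context: $E$ denotes expectation. The partial (incomplete) Bell polynomials $B_{n,k}$ are defined by $\frac{1}{k!}\big(\sum_{m=1}^{\infty}x_m\frac{t^m}{m!}\big)^k=\sum_{n=k}^{\infty}B_{n,k}(x_1,\dots,x_{n-k+1})\frac{t^n}{n!}$; explicitly $B_{n,k}(x_1,\dots,x_{n-k+1})=\sum \frac{n!}{j_1!\cdots j_{n-k+1}!}\prod_{i}\big(\frac{x_i}{i!}\big)^{j_i}$, the sum over nonnegative integers $j_1,\dots,j_{n-k+1}$ with $\sum j_i=k$ and $\sum i\,j_i=n$ (with $B_{0,0}=1$). *)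

theory Defs
  imports "HOL-Probability.Probability" "HOL-Computational_Algebra.Formal_Power_Series"
begin

(* B_{n,k}, from the exponential generating function (\<Sum>m\<ge>1. x_m t^m / m!)^k / k!.
   The argument is a whole sequence (x 0 is ignored), of which only the entries
   x 1, ..., x (n - k + 1) affect the value; the value is 0 for n < k. *)
definition partial_bell :: "nat \<Rightarrow> nat \<Rightarrow> (nat \<Rightarrow> real) \<Rightarrow> real" where
  "partial_bell n k x =
     fact n * fps_nth (fps_const (1 / fact k) *
                       Abs_fps (\<lambda>m. if m = 0 then 0 else x m / fact m) ^ k) n"

(* prob_r_stirling M Y r n k is the number with upper entry n + r and lower entry k + r.
   The defining expansion is required for all t in some neighbourhood of 0, which fixes the
   coefficients; the series starts at n = k, so the entries with n < k are 0. *)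
definition prob_r_stirling ::
    "'a measure \<Rightarrow> ('a \<Rightarrow> real) \<Rightarrow> nat \<Rightarrow> nat \<Rightarrow> nat \<Rightarrow> real" where
  "prob_r_stirling M Y r n k =
     (THE a :: nat \<Rightarrow> real. (\<forall>i<k. a i = 0) \<and>
        (\<forall>\<^sub>F t in nhds 0.
           (\<lambda>i. a i * (t ^ i / fact i)) sums
             (1 / fact k * ((\<integral>\<omega>. exp (t * Y \<omega>) \<partial>M) - 1) ^ k * exp (real r * t)))) n"

definition prob_r_bell_poly ::
    "'a measure \<Rightarrow> ('a \<Rightarrow> real) \<Rightarrow> nat \<Rightarrow> nat \<Rightarrow> real \<Rightarrow> real" where
  "prob_r_bell_poly M Y r n x = (\<Sum>k\<le>n. prob_r_stirling M Y r n k * x ^ k)"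

end

theory Submission
  imports Defs
begin

text \<open>
  The moment generating function of \<open>Y\<close> is represented near \<open>0\<close> by the series with coefficients
  \<open>E[Y\<^sup>m] / m!\<close>. Writing \<open>A\<close> for that series without its constant term, uniqueness of power
  series coefficients identifies the Stirling numbers as \<open>n! [t\<^sup>n] A\<^sup>k e\<^sup>r\<^sup>t / k!\<close>. Expanding the
  Cauchy product with \<open>e\<^sup>r\<^sup>t\<close> produces the binomial sum, and homogeneity of degree \<open>k\<close> absorbs
  \<open>x\<^sup>k\<close> into the arguments of \<open>B\<^sub>l\<^sub>,\<^sub>k\<close>; the terms with \<open>k > l\<close> vanish because \<open>A\<close> starts at
  degree one.
\<close>

text \<open>Bridges the pointwise convergence used in \<open>prob_r_stirling_def\<close> and
  \<open>has_fps_expansion\<close>, whose closure rules then apply. From right to left, convergence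
  at every real point of (0, d) forces the radius of convergence to be at least d.\<close>

lemma has_fps_expansion_iff_eventually_sums:
  fixes f :: "real \<Rightarrow> real"
  shows "f has_fps_expansion F \<longleftrightarrow> (\<forall>\<^sub>F t in nhds 0. (\<lambda>i. fps_nth F i * t ^ i) sums f t)"
    (is "?L \<longleftrightarrow> ?R")
proof
  assume L: ?L
  then have "\<forall>\<^sub>F t in nhds 0. t \<in> eball 0 (fps_conv_radius F)"
    by (intro eventually_nhds_in_open) (auto simp: has_fps_expansion_def zero_ereal_def)
  moreover have "\<forall>\<^sub>F t in nhds 0. eval_fps F t = f t"
    using L by (simp add: has_fps_expansion_def)
  ultimately show ?R
  proof eventually_elim
    case (elim t)
    then show ?case using sums_eval_fps[of t F] by simp
  qed
next
  assume R: ?R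
  then obtain d where d: "d > 0" "\<And>t. \<bar>t\<bar> < d \<Longrightarrow> (\<lambda>i. fps_nth F i * t ^ i) sums f t"
    by (auto simp: eventually_nhds_metric dist_real_def)
  have "ereal d \<le> fps_conv_radius F"
    unfolding fps_conv_radius_def
  proof (rule conv_radius_geI_ex')
    fix s :: real assume "0 < s" "ereal s < ereal d"
    then show "summable (\<lambda>n. fps_nth F n * of_real s ^ n)"
      using d(2)[of s] by (simp add: sums_iff)
  qed
  then have "fps_conv_radius F > 0"
    using d(1) by (metis ereal_less(2) less_le_trans)
  moreover have "\<forall>\<^sub>F t in nhds 0. eval_fps F t = f t"
    using R by eventually_elim (simp add: eval_fps_def sums_iff)
  ultimately show ?L
    by (simp add: has_fps_expansion_def)
qed

text \<open>Induction on the index for all series at once: the derivative of \<open>F\<close> again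
  represents 0, and its coefficient at n is (n + 1) times the coefficient of \<open>F\<close> at n +
  1.\<close>

lemma has_fps_expansion_zero_imp_zero:
  fixes F :: "real fps"
  assumes "(\<lambda>_. 0) has_fps_expansion F"
  shows "F = 0"
proof (rule fps_ext)
  fix n
  show "fps_nth F n = fps_nth 0 n"
    using assms
  proof (induction n arbitrary: F)
    case 0
    then have "eval_fps F 0 = 0"
      by (auto simp: has_fps_expansion_def dest: eventually_nhds_x_imp_x)
    then show ?case by (simp add: eval_fps_at_0)
  next
    case (Suc n)
    have "(\<lambda>_. 0) has_fps_expansion fps_deriv F"
      using has_fps_expansion_deriv[OF Suc.prems] by simp
    from Suc.IH[OF this] show ?case by simp
  qed
qed

lemma has_fps_expansion_unique_real:
  fixes F G :: "real fps"
  assumes "f has_fps_expansion F" "f has_fps_expansion G"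
  shows "F = G"
  using has_fps_expansion_zero_imp_zero[of "F - G"] has_fps_expansion_diff[OF assms] by simp

text \<open>Domination by exp u + exp (- u), which is why integrability is required on both sides of
  0.\<close>

lemma integrable_exp_abs:
  fixes Y :: "'a \<Rightarrow> real"
  assumes "Y \<in> borel_measurable M"
    and "integrable M (\<lambda>\<omega>. exp (t * Y \<omega>))" "integrable M (\<lambda>\<omega>. exp (- t * Y \<omega>))"
  shows "integrable M (\<lambda>\<omega>. exp \<bar>t * Y \<omega>\<bar>)"
proof (rule Bochner_Integration.integrable_bound)
  show "integrable M (\<lambda>\<omega>. exp (t * Y \<omega>) + exp (- t * Y \<omega>))"
    using assms(2,3) by simp
  show "AE \<omega> in M. norm (exp \<bar>t * Y \<omega>\<bar>) \<le> norm (exp (t * Y \<omega>) + exp (- t * Y \<omega>))"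
    unfolding mult_minus_left by (intro AE_I2) (smt (verit) exp_gt_zero real_norm_def)
qed (use assms(1) in measurable)

text \<open>Integrate the exponential series term by term. The partial sums of absolute values stay
  below \<open>exp \<bar>t * Y \<omega>\<bar>\<close>, which is integrable, so sum and integral may
  be exchanged.\<close>

lemma mgf_sums_moments:
  fixes Y :: "'a \<Rightarrow> real"
  assumes [measurable]: "Y \<in> borel_measurable M"
    and "integrable M (\<lambda>\<omega>. exp (t * Y \<omega>))" "integrable M (\<lambda>\<omega>. exp (- t * Y \<omega>))"
  shows "(\<lambda>m. (\<integral>\<omega>. Y \<omega> ^ m \<partial>M) / fact m * t ^ m) sums (\<integral>\<omega>. exp (t * Y \<omega>) \<partial>M)"
proof -
  let ?f = "\<lambda>m \<omega>. (t * Y \<omega>) ^ m / fact m"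
  have exp_sums: "(\<lambda>m. z ^ m / fact m) sums exp z" for z :: real
    using exp_converges[of z] by (simp add: field_simps)
  have int_exp: "integrable M (\<lambda>\<omega>. exp \<bar>t * Y \<omega>\<bar>)"
    by (rule integrable_exp_abs) (use assms in auto)
  have partial_le: "(\<Sum>m<N. norm (?f m \<omega>)) \<le> exp \<bar>t * Y \<omega>\<bar>" for N \<omega>
    using sum_le_suminf[of "\<lambda>m. \<bar>t * Y \<omega>\<bar> ^ m / fact m" "{..<N}"] exp_sums[of "\<bar>t * Y \<omega>\<bar>"]
    by (simp add: sums_iff power_abs)
  have int_f: "integrable M (?f m)" for m
  proof (rule Bochner_Integration.integrable_bound[OF int_exp])
    \<comment> \<open>Each term is one summand of a dominated partial sum, so it inherits the
      integrable bound.\<close>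
    have "norm (?f m \<omega>) \<le> (\<Sum>i<Suc m. norm (?f i \<omega>))" for \<omega>
      by (rule member_le_sum) auto
    with partial_le[of _ "Suc m"]
    show "AE \<omega> in M. norm (?f m \<omega>) \<le> norm (exp \<bar>t * Y \<omega>\<bar>)"
      by (intro AE_I2) (smt (verit) exp_gt_zero real_norm_def)
  qed measurable
  have "summable (\<lambda>m. \<integral>\<omega>. norm (?f m \<omega>) \<partial>M)"
  proof (rule summableI_nonneg_bounded)
    fix N
    have "(\<Sum>m<N. \<integral>\<omega>. norm (?f m \<omega>) \<partial>M) = (\<integral>\<omega>. (\<Sum>m<N. norm (?f m \<omega>)) \<partial>M)"
      by (intro Bochner_Integration.integral_sum[symmetric] integrable_norm int_f)
    also have "\<dots> \<le> (\<integral>\<omega>. exp \<bar>t * Y \<omega>\<bar> \<partial>M)"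
      using int_f int_exp partial_le
      by (intro integral_mono Bochner_Integration.integrable_sum integrable_norm)
    finally show "(\<Sum>m<N. \<integral>\<omega>. norm (?f m \<omega>) \<partial>M) \<le> (\<integral>\<omega>. exp \<bar>t * Y \<omega>\<bar> \<partial>M)" .
  qed simp
  moreover have "AE \<omega> in M. summable (\<lambda>m. norm (?f m \<omega>))"
    using exp_sums[of "\<bar>t * Y _\<bar>"] by (intro AE_I2) (simp add: sums_iff power_abs)
  ultimately have "(\<lambda>m. \<integral>\<omega>. ?f m \<omega> \<partial>M) sums (\<integral>\<omega>. (\<Sum>m. ?f m \<omega>) \<partial>M)"
    using int_f by (intro sums_integral)
  moreover have "(\<integral>\<omega>. ?f m \<omega> \<partial>M) = (\<integral>\<omega>. Y \<omega> ^ m \<partial>M) / fact m * t ^ m" for m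
    by (simp add: power_mult_distrib)
  ultimately show ?thesis
    using exp_sums by (simp add: sums_iff)
qed

lemma mgf_has_fps_expansion:
  fixes Y :: "'a \<Rightarrow> real"
  assumes "Y \<in> borel_measurable M" "\<delta> > 0"
    and "\<And>t. \<bar>t\<bar> < \<delta> \<Longrightarrow> integrable M (\<lambda>\<omega>. exp (t * Y \<omega>))"
  shows "(\<lambda>t. \<integral>\<omega>. exp (t * Y \<omega>) \<partial>M) has_fps_expansion
           Abs_fps (\<lambda>m. (\<integral>\<omega>. Y \<omega> ^ m \<partial>M) / fact m)"
  unfolding has_fps_expansion_iff_eventually_sums eventually_nhds_metric
proof (intro exI[of _ \<delta>] conjI allI impI)
  fix t :: real assume "dist t 0 < \<delta>"
  then have "\<bar>t\<bar> < \<delta>" "\<bar>- t\<bar> < \<delta>" by (auto simp: dist_real_def)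
  then show "(\<lambda>m. fps_nth (Abs_fps (\<lambda>m. (\<integral>\<omega>. Y \<omega> ^ m \<partial>M) / fact m)) m * t ^ m) sums
      (\<integral>\<omega>. exp (t * Y \<omega>) \<partial>M)"
    unfolding fps_nth_Abs_fps using assms(1,3) by (intro mgf_sums_moments)
qed fact

lemma prob_r_stirling_eq:
  fixes Y :: "'a \<Rightarrow> real"
  assumes "prob_space M" "Y \<in> borel_measurable M" "\<delta> > 0"
    and "\<And>t. \<bar>t\<bar> < \<delta> \<Longrightarrow> integrable M (\<lambda>\<omega>. exp (t * Y \<omega>))"
  defines "A \<equiv> Abs_fps (\<lambda>m. if m = 0 then 0 else (\<integral>\<omega>. Y \<omega> ^ m \<partial>M) / fact m)"
  shows "prob_r_stirling M Y r n k =
           fact n * fps_nth (fps_const (1 / fact k) * A ^ k * fps_exp (real r)) n"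
proof -
  let ?g = "\<lambda>t. 1 / fact k * ((\<integral>\<omega>. exp (t * Y \<omega>) \<partial>M) - 1) ^ k * exp (real r * t)"
  define G where "G = fps_const (1 / fact k) * A ^ k * fps_exp (real r)"
  interpret prob_space M by fact
  \<comment> \<open>Total mass 1 makes the zeroth moment 1, so subtracting 1 removes exactly the
    constant term.\<close>
  have "Abs_fps (\<lambda>m. (\<integral>\<omega>. Y \<omega> ^ m \<partial>M) / fact m) - 1 = A"
    by (rule fps_ext) (simp add: A_def prob_space)
  then have "(\<lambda>t. (\<integral>\<omega>. exp (t * Y \<omega>) \<partial>M) - 1) has_fps_expansion A"
    using has_fps_expansion_diff[OF mgf_has_fps_expansion[OF assms(2-4)] has_fps_expansion_1]
    by simp
  then have "(\<lambda>t. ((\<integral>\<omega>. exp (t * Y \<omega>) \<partial>M) - 1) ^ k) has_fps_expansion A ^ k"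
    by (induction k) (auto intro: has_fps_expansion_mult)
  then have G: "?g has_fps_expansion G"
    unfolding G_def by (intro fps_expansion_intros)
  \<comment> \<open>As \<open>A\<close> has no constant term, \<open>A ^ k\<close> starts at degree
    k or later; this yields the clause on \<open>i < k\<close> in the definite description.\<close>
  have "fps_nth (A ^ k) i = 0" if "i < k" for i
    using startsby_zero_power_prefix[of A k] that by (simp add: A_def)
  then have G0: "fps_nth G i = 0" if "i < k" for i
    using that by (simp add: G_def fps_mult_nth mult.assoc)
  \<comment> \<open>Passing from exponential to ordinary coefficients turns the defining condition
    into an expansion, so existence follows from \<open>G\<close> and uniqueness from that of power
    series coefficients.\<close>
  have expansion_iff: "(\<forall>\<^sub>F t in nhds 0. (\<lambda>i. a i * (t ^ i / fact i)) sums ?g t) \<longleftrightarrow>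
      ?g has_fps_expansion Abs_fps (\<lambda>i. a i / fact i)" for a
    unfolding has_fps_expansion_iff_eventually_sums by simp
  have "(THE a. (\<forall>i<k. a i = 0) \<and>
          (\<forall>\<^sub>F t in nhds 0. (\<lambda>i. a i * (t ^ i / fact i)) sums ?g t)) = (\<lambda>i. fact i * fps_nth G i)"
    unfolding expansion_iff
  proof (rule the_equality)
    show "(\<forall>i<k. fact i * fps_nth G i = 0) \<and>
        ?g has_fps_expansion Abs_fps (\<lambda>i. fact i * fps_nth G i / fact i)"
      using G G0 by (simp add: fps_nth_inverse)
  next
    fix a
    assume "(\<forall>i<k. a i = 0) \<and> ?g has_fps_expansion Abs_fps (\<lambda>i. a i / fact i)"
    then have "Abs_fps (\<lambda>i. a i / fact i) = G"
      using G has_fps_expansion_unique_real by blast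
    then show "a = (\<lambda>i. fact i * fps_nth G i)"
      by auto
  qed
  then show ?thesis
    unfolding prob_r_stirling_def G_def by simp
qed

text \<open>For exponential generating functions the Cauchy product is a binomial convolution, and
  \<open>fps_exp r\<close> contributes the powers of r.\<close>

lemma fps_exp_mult_nth:
  "fact n * fps_nth (F * fps_exp r) n =
     (\<Sum>l\<le>n. real (n choose l) * (fact l * fps_nth F l) * r ^ (n - l))"
proof -
  have "fact n / fact (n - l) = real (n choose l) * fact l" if "l \<le> n" for l
    using that by (simp add: binomial_fact)
  then show ?thesis
    unfolding fps_mult_nth sum_distrib_left atLeast0AtMost
    by (intro sum.cong) (auto simp: field_simps)
qed

text \<open>Scaling the arguments scales the generating series by c, hence its k-th power by
  \<open>c ^ k\<close>.\<close>

lemma partial_bell_scale: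
  "partial_bell n k (\<lambda>i. c * x i) = c ^ k * partial_bell n k x"
proof -
  have "Abs_fps (\<lambda>m. if m = 0 then 0 else c * x m / fact m) =
      fps_const c * Abs_fps (\<lambda>m. if m = 0 then 0 else x m / fact m)"
    by (rule fps_ext) simp
  then show ?thesis
    by (simp add: partial_bell_def power_mult_distrib fps_const_power)
qed

lemma partial_bell_eq_0: "n < k \<Longrightarrow> partial_bell n k x = 0"
  using startsby_zero_power_prefix[of "Abs_fps (\<lambda>m. if m = 0 then 0 else x m / fact m)" k]
  by (simp add: partial_bell_def)

theorem theorem2p3:
  fixes M :: "'a measure" and Y :: "'a \<Rightarrow> real" and \<delta> x :: real and r n :: nat
  assumes "prob_space M"
    and "Y \<in> borel_measurable M"
    and "\<delta> > 0"
    and "\<And>t. \<bar>t\<bar> < \<delta> \<Longrightarrow> integrable M (\<lambda>\<omega>. exp (t * Y \<omega>))"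
    and "r > 0"
  shows "prob_r_bell_poly M Y r n x =
    (\<Sum>l\<le>n. real (n choose l) *
       (\<Sum>k\<le>l. partial_bell l k (\<lambda>i. x * (\<integral>\<omega>. Y \<omega> ^ i \<partial>M))) * real r ^ (n - l))"
proof -
  let ?B = "\<lambda>l k. partial_bell l k (\<lambda>i. \<integral>\<omega>. Y \<omega> ^ i \<partial>M)"
  \<comment> \<open>Before the factor \<open>fps_exp (real r)\<close> enters, the series is the one
    that defines \<open>partial_bell\<close> at the moments of Y.\<close>
  have "prob_r_stirling M Y r n k = (\<Sum>l\<le>n. real (n choose l) * ?B l k * real r ^ (n - l))"
    for k
    unfolding partial_bell_def fps_exp_mult_nth[symmetric]
    using assms(1-4) by (rule prob_r_stirling_eq)
  then have "prob_r_bell_poly M Y r n x =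
      (\<Sum>k\<le>n. (\<Sum>l\<le>n. real (n choose l) * ?B l k * real r ^ (n - l)) * x ^ k)"
    by (simp add: prob_r_bell_poly_def)
  \<comment> \<open>Both indices still range up to n, so the sums swap freely; the cut to
    \<open>k \<le> l\<close> comes afterwards, since the entries with \<open>l < k\<close> are
    0.\<close>
  also have "\<dots> = (\<Sum>l\<le>n. \<Sum>k\<le>n. real (n choose l) * ?B l k * real r ^ (n - l) * x ^ k)"
    unfolding sum_distrib_right by (rule sum.swap)
  also have "\<dots> = (\<Sum>l\<le>n. real (n choose l) * (\<Sum>k\<le>n. x ^ k * ?B l k) * real r ^ (n - l))"
    unfolding sum_distrib_left sum_distrib_right by (intro sum.cong) (auto simp: mult_ac)
  also have "\<dots> = (\<Sum>l\<le>n. real (n choose l) * (\<Sum>k\<le>l. x ^ k * ?B l k) * real r ^ (n - l))"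
  proof (rule sum.cong[OF refl])
    fix l assume "l \<in> {..n}"
    then have "(\<Sum>k\<le>n. x ^ k * ?B l k) = (\<Sum>k\<le>l. x ^ k * ?B l k)"
      by (intro sum.mono_neutral_right) (auto simp: partial_bell_eq_0)
    then show "real (n choose l) * (\<Sum>k\<le>n. x ^ k * ?B l k) * real r ^ (n - l) =
        real (n choose l) * (\<Sum>k\<le>l. x ^ k * ?B l k) * real r ^ (n - l)"
      by simp
  qed
  finally show ?thesis
    unfolding partial_bell_scale .
qed

end
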